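(* Let $\alpha\in(1,2)$, let $f_k$ ($k\in\mathbb N$) be as in an admissible system, let $D_k:=\lfloor4^{\alpha k}\rfloor$ and $\varphi_k:=\frac1{D_k}\sum_{j=0}^{D_k-1}f_k\circ T^j$. Define $V_n(\varphi):=\sum_{k>\frac1{2\alpha}\log n}S_n\!\left(\varphi_k-\int\varphi_k\,dm\right)$ (the series converging in $L^1(m)$). Then $n^{-1/\alpha}V_n(\varphi)\to0$ in probability as $n\to\infty$.
   Context: $(\mathcal X,\mathcal B,m,T)$ is an ergodic, aperiodic probability preserving system; $\log$ is base $2$; $S_n(h):=\sum_{j=0}^{n-1}h\circ T^j$. $S_\alpha(\sigma,\beta,\mu)$ denotes the stable law with characteristic function $\exp\{-\sigma^\alpha|\theta|^\alpha(1-i\beta\,\mathrm{sign}(\theta)\tan(\pi\alpha/2))+i\mu\theta\}$ ($\alpha\neq1$). Triangular array: on $(\Omega,\mathcal F,\mathbb P)$ let $\{X_k(m):k,m\in\mathbb N\}$ be independent with $X_k(m)\sim S_\alpha(k^{-1/\alpha},1,0)$; $Y_k(m):=X_k(m)\mathbf 1_{[2^k\le X_k(m)\le4^k]}$; $Z_k(m):=\sum_{j=8^k}^{16^k}\frac{j}{4^k}\mathbf 1_{[j/4^k\le Y_k(m)<(j+1)/4^k]}$. Let $d_k:=4^{k^2}$. An admissible system is a sequence of measurable $f_k:\mathcal X\to\mathbb R$ such that the family $\{f_k\circ T^j:k\in\mathbb N,0\le j<2d_k\}$ has under $m$ the same joint distribution as $\{Z_k(j+1):k\in\mathbb N,0\le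 j<2d_k\}$, together with $g_k:=f_k\circ T^{d_k}$. *)

theory Defs
  imports "HOL-Probability.Probability"
begin

definition ergodic_aperiodic_pps :: "'a measure \<Rightarrow> ('a \<Rightarrow> 'a) \<Rightarrow> bool" where
  "ergodic_aperiodic_pps M T \<longleftrightarrow>
     prob_space M \<and> T \<in> M \<rightarrow>\<^sub>M M \<and> distr M M T = M \<and>
     (\<forall>A\<in>sets M. T -` A \<inter> space M = A \<longrightarrow> measure M A = 0 \<or> measure M A = 1) \<and>
     (AE x in M. \<forall>n::nat. n \<ge> 1 \<longrightarrow> (T ^^ n) x \<noteq> x)"

definition birkhoff_sum :: "('a \<Rightarrow> 'a) \<Rightarrow> nat \<Rightarrow> ('a \<Rightarrow> real) \<Rightarrow> 'a \<Rightarrow> real" where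
  "birkhoff_sum T n h x = (\<Sum>j<n. h ((T ^^ j) x))"

text \<open>N is the stable law S_alpha(sigma,beta,mu) (alpha /= 1), via its characteristic function.\<close>
definition stable_law :: "real \<Rightarrow> real \<Rightarrow> real \<Rightarrow> real \<Rightarrow> real measure \<Rightarrow> bool" where
  "stable_law \<alpha> \<sigma> \<beta> \<mu> N \<longleftrightarrow> real_distribution N \<and>
     (\<forall>\<theta>::real. char N \<theta> =
        exp (- complex_of_real (\<sigma> powr \<alpha> * \<bar>\<theta>\<bar> powr \<alpha>)
               * (1 - \<i> * complex_of_real (\<beta> * sgn \<theta> * tan (pi * \<alpha> / 2)))
             + \<i> * complex_of_real (\<mu> * \<theta>)))"

definition triangular_array :: "real \<Rightarrow> 'b measure \<Rightarrow> (nat \<Rightarrow> nat \<Rightarrow> 'b \<Rightarrow> real) \<Rightarrow> bool" where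
  "triangular_array \<alpha> P X \<longleftrightarrow> prob_space P \<and>
     prob_space.indep_vars P (\<lambda>_. borel) (\<lambda>(k, m). X k m) {(k, m). k \<ge> 1 \<and> m \<ge> 1} \<and>
     (\<forall>k\<ge>1. \<forall>m\<ge>1. stable_law \<alpha> (real k powr (-1 / \<alpha>)) 1 0 (distr P borel (X k m)))"

definition Ytr :: "nat \<Rightarrow> real \<Rightarrow> real" where
  "Ytr k x = x * indicator {2 ^ k .. 4 ^ k} x"

definition Zq :: "nat \<Rightarrow> real \<Rightarrow> real" where
  "Zq k x = (\<Sum>j\<in>{8 ^ k .. 16 ^ k :: nat}. (real j / 4 ^ k) *
              indicator {real j / 4 ^ k ..< (real j + 1) / 4 ^ k} (Ytr k x))"

definition dk :: "nat \<Rightarrow> nat" where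
  "dk k = 4 ^ (k ^ 2)"

definition adm_index :: "(nat \<times> nat) set" where
  "adm_index = {(k, j). k \<ge> 1 \<and> j < 2 * dk k}"

definition admissible_system ::
  "'a measure \<Rightarrow> ('a \<Rightarrow> 'a) \<Rightarrow> 'b measure \<Rightarrow> (nat \<Rightarrow> nat \<Rightarrow> 'b \<Rightarrow> real) \<Rightarrow> (nat \<Rightarrow> 'a \<Rightarrow> real) \<Rightarrow> bool" where
  "admissible_system M T P X f \<longleftrightarrow>
     (\<forall>k\<ge>1. f k \<in> borel_measurable M) \<and>
     distr M (PiM adm_index (\<lambda>_. borel)) (\<lambda>x. \<lambda>i\<in>adm_index. f (fst i) ((T ^^ snd i) x))
   = distr P (PiM adm_index (\<lambda>_. borel)) (\<lambda>\<omega>. \<lambda>i\<in>adm_index. Zq (fst i) (X (fst i) (snd i + 1) \<omega>))"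

definition Dk :: "real \<Rightarrow> nat \<Rightarrow> nat" where
  "Dk \<alpha> k = nat \<lfloor>4 powr (\<alpha> * real k)\<rfloor>"

definition phik :: "real \<Rightarrow> ('a \<Rightarrow> 'a) \<Rightarrow> (nat \<Rightarrow> 'a \<Rightarrow> real) \<Rightarrow> nat \<Rightarrow> 'a \<Rightarrow> real" where
  "phik \<alpha> T f k x = (1 / real (Dk \<alpha> k)) * (\<Sum>j<Dk \<alpha> k. f k ((T ^^ j) x))"

end

theory Submission
  imports Defs "HOL-Real_Asymp.Real_Asymp"
begin

text \<open>
  Write S_n(phi_k - int phi_k) = sum_{m < n + D_k} c_m (f_k o T^m - int f_k), where D_k c_m is the
  number of windows [i, i + D_k), i < n, containing m; hence sum c_m^2 <= n^2 / D_k.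
  For k > log n / (2 alpha) one has n <= D_k <= d_k, so all indices m are below 2 d_k and
  admissibility replaces the f_k o T^m by independent copies of Z_k. The stable tail
  P(|X| >= t) <= C sigma^alpha t^(-alpha) bounds E Z_k^2 by C (4 / 2^alpha)^(2k) / k, and with
  D_k ~ 4^(alpha k) this gives ||S_n(phi_k - int phi_k)||_1 <= C n rho^k / sqrt k for
  rho = 4^(1 - alpha) < 1. Summing over k > log n / (2 alpha) yields
  ||V_n||_1 <= C n^(1/alpha) / sqrt (log n), and Markov's inequality concludes.
\<close>

section \<open>Tails of stable laws\<close>

text \<open>The truncation inequality, as in the proof of \<open>levy_continuity1\<close>.\<close>
lemma (in real_distribution) measure_abs_ge_le_char_integral:
  assumes "u > 0"
  shows "u * measure M {x. abs x \<ge> 2 / u} \<le> Re (CLBINT t:{-u..u}. 1 - char M t)"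
proof -
  have integral_one_minus_iexp: "(CLBINT t:{-u..u}. 1 - iexp (t * x)) = 2 * (u - sin (u * x) / x)"
    if "x \<noteq> 0" for x
  proof -
    have "(CLBINT t:{-u..u}. 1 - iexp (t * x)) = (CLBINT t=-u..u. 1 - iexp (t * x))"
      using \<open>u > 0\<close> by (subst interval_integral_Icc, auto)
    also have "\<dots> = (CLBINT t=-u..ereal 0. 1 - iexp (t * x)) + (CLBINT t= ereal 0..u. 1 - iexp (t * x))"
      using \<open>u > 0\<close>
      by (subst interval_integral_sum; force simp add: interval_integrable_isCont)
    also have "\<dots> = (CLBINT t=ereal 0..u. 1 - iexp (t * -x)) + (CLBINT t=ereal 0..u. 1 - iexp (t * x))"
      by (subst interval_integral_reflect, auto)
    also have "\<dots> = CLBINT xa=ereal 0..ereal u. 1 - iexp (xa * - x) + (1 - iexp (xa * x))"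
      by (subst interval_lebesgue_integral_add (2) [symmetric]) (auto simp: interval_integrable_isCont)
    also have "\<dots> = (LBINT t=ereal 0..u. 2 - 2 * cos (t * x))"
      unfolding exp_Euler cos_of_real by (simp flip: interval_lebesgue_integral_of_real)
    also have "\<dots> = 2 * u - 2 * sin (u * x) / x"
      by (subst interval_lebesgue_integral_diff)
         (auto intro!: interval_integrable_isCont
               simp: interval_lebesgue_integral_of_real integral_cos [OF \<open>x \<noteq> 0\<close>] mult.commute[of _ x])
    finally show ?thesis
      by (simp add: field_simps)
  qed
  interpret P: pair_sigma_finite M lborel ..
  have [simp]: "measure M UNIV = 1" by (metis prob_space space_eq_univ)
  have [simp]: "complex_integrable M (\<lambda>t. exp (\<i> * complex_of_real (x * t)))" for x
    by (rule integrable_const_bound [where B = 1], auto)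
  have integrable_2d: "set_integrable (M \<Otimes>\<^sub>M lborel) (UNIV \<times> {- u..u})
      (\<lambda>a. 1 - exp (\<i> * complex_of_real (snd a * fst a)))"
    using \<open>0 < u\<close>
    unfolding set_integrable_def
    by (intro integrableI_bounded_set_indicator [where B="2"])
       (auto simp: lborel.emeasure_pair_measure_Times ennreal_mult_less_top not_less top_unique
             split: split_indicator
             intro!: order_trans [OF norm_triangle_ineq4])
  have "(CLBINT t:{-u..u}. 1 - char M t) = (CLBINT t:{-u..u}. (CLINT x | M. 1 - iexp (t * x)))"
    unfolding char_def by (rule set_lebesgue_integral_cong, auto simp del: of_real_mult)
  also have "\<dots> = (CLBINT t. (CLINT x | M. indicator {-u..u} t *\<^sub>R (1 - iexp (t * x))))"
    unfolding set_lebesgue_integral_def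
    by (rule Bochner_Integration.integral_cong) (auto split: split_indicator)
  also have "\<dots> = (CLINT x | M. (CLBINT t:{-u..u}. 1 - iexp (t * x)))"
    using integrable_2d
    by (subst P.Fubini_integral)
       (auto simp: indicator_times split_beta' set_integrable_def set_lebesgue_integral_def)
  also have "\<dots> = (CLINT x | M. (if x = 0 then 0 else 2 * (u - sin (u * x) / x)))"
    by (intro Bochner_Integration.integral_cong, auto simp add: integral_one_minus_iexp simp del: of_real_mult)
  also have "\<dots> = (LINT x | M. (if x = 0 then 0 else 2 * (u - sin (u * x) / x)))"
    by (rule integral_complex_of_real)
  finally have "Re (CLBINT t:{-u..u}. 1 - char M t) =
      (LINT x | M. (if x = 0 then 0 else 2 * (u - sin (u * x) / x)))" by simp
  also have "\<dots> \<ge> (LINT x : {x. abs x \<ge> 2 / u} | M. u)"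
  proof -
    have "complex_integrable M (\<lambda>x. CLBINT t:{-u..u}. 1 - iexp (snd (x, t) * fst (x, t)))"
      using integrable_2d unfolding set_integrable_def set_lebesgue_integral_def
      by (intro P.integrable_fst) (simp add: indicator_times split_beta')
    hence "complex_integrable M (\<lambda>x. if x = 0 then 0 else 2 * (u - sin (u * x) / x))"
      by (subst Bochner_Integration.integrable_cong)
         (auto simp add: integral_one_minus_iexp simp del: of_real_mult)
    hence integrable: "integrable M (\<lambda>x. if x = 0 then 0 else 2 * (u - sin (u * x) / x))"
      unfolding complex_of_real_integrable_eq .
    have "2 * sin x \<le> x" if "2 \<le> x" for x :: real
      by (rule order_trans[OF _ \<open>2 \<le> x\<close>]) auto
    moreover have "x \<le> 2 * sin x" if "x \<le> - 2" for x :: real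
      by (rule order_trans[OF \<open>x \<le> - 2\<close>]) auto
    moreover have "x < 0 \<Longrightarrow> x \<le> sin x" for x :: real
      using sin_x_le_x[of "-x"] by simp
    ultimately show ?thesis
      using \<open>u > 0\<close> unfolding set_lebesgue_integral_def
      by (intro integral_mono [OF _ integrable])
         (auto simp: divide_simps sin_x_le_x mult.commute[of u] mult_neg_pos top_unique
               less_top[symmetric] split: split_indicator)
  qed
  also (xtrans) have "(LINT x : {x. abs x \<ge> 2 / u} | M. u) = u * measure M {x. abs x \<ge> 2 / u}"
    unfolding set_lebesgue_integral_def by (simp add: emeasure_eq_measure)
  finally show ?thesis .
qed

lemma norm_one_minus_exp_Complex_le:
  assumes "a \<le> 0"
  shows "cmod (1 - exp (Complex a b)) \<le> - a + \<bar>b\<bar>"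
proof -
  have exp_eq: "exp (Complex a b) = complex_of_real (exp a) * iexp b"
    by (simp add: complex_eq_iff exp_Euler cos_of_real sin_of_real Re_exp Im_exp)
  have "1 - exp (Complex a b) = complex_of_real (1 - exp a) + complex_of_real (exp a) * (1 - iexp b)"
    by (simp add: exp_eq algebra_simps)
  hence "cmod (1 - exp (Complex a b))
      \<le> cmod (complex_of_real (1 - exp a)) + cmod (complex_of_real (exp a) * (1 - iexp b))"
    by (metis norm_triangle_ineq)
  also have "cmod (complex_of_real (1 - exp a)) = 1 - exp a"
    using assms by (simp only: norm_of_real) simp
  also have "cmod (complex_of_real (exp a) * (1 - iexp b)) = exp a * cmod (iexp b - 1)"
    by (simp add: norm_mult norm_minus_commute)
  also have "cmod (iexp b - 1) \<le> \<bar>b\<bar>"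
    using iexp_approx1[of b 0] by simp
  hence "exp a * cmod (iexp b - 1) \<le> 1 * \<bar>b\<bar>"
    using assms by (intro mult_mono) auto
  moreover have "1 - exp a \<le> - a" using exp_ge_add_one_self[of a] by linarith
  ultimately show ?thesis by linarith
qed

definition stable_tail_const :: "real \<Rightarrow> real" where
  "stable_tail_const \<alpha> = 2 powr (1 + \<alpha>) * (1 + \<bar>tan (pi * \<alpha> / 2)\<bar>)"

lemma stable_tail_const_nonneg: "stable_tail_const \<alpha> \<ge> 0"
  by (simp add: stable_tail_const_def)

lemma stable_law_tail_bound:
  assumes stable: "stable_law \<alpha> \<sigma> \<beta> 0 N" and "\<bar>\<beta>\<bar> \<le> 1" and "0 < \<alpha>" and "0 < t"
  shows "measure N {x. t \<le> \<bar>x\<bar>} \<le> stable_tail_const \<alpha> * \<sigma> powr \<alpha> / t powr \<alpha>"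
proof -
  interpret real_distribution N using stable unfolding stable_law_def by auto
  define c where "c = tan (pi * \<alpha> / 2)"
  define u where "u = 2 / t"
  have u: "u > 0" using \<open>0 < t\<close> by (simp add: u_def)
  define K where "K = (1 + \<bar>c\<bar>) * \<sigma> powr \<alpha> * u powr \<alpha>"
  have one_minus_char_le: "cmod (1 - char N \<theta>) \<le> K" if "\<theta> \<in> {-u..u}" for \<theta>
  proof -
    define s where "s = \<sigma> powr \<alpha> * \<bar>\<theta>\<bar> powr \<alpha>"
    have s0: "s \<ge> 0" by (simp add: s_def)
    have exponent: "- complex_of_real (\<sigma> powr \<alpha> * \<bar>\<theta>\<bar> powr \<alpha>)
               * (1 - \<i> * complex_of_real (\<beta> * sgn \<theta> * tan (pi * \<alpha> / 2)))
             + \<i> * complex_of_real (0 * \<theta>) = Complex (-s) (s * (\<beta> * sgn \<theta> * c))"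
      by (simp add: complex_eq_iff s_def c_def)
    have "char N \<theta> = exp (Complex (-s) (s * (\<beta> * sgn \<theta> * c)))"
      using stable unfolding stable_law_def exponent[symmetric] by blast
    hence "cmod (1 - char N \<theta>) \<le> s + \<bar>s * (\<beta> * sgn \<theta> * c)\<bar>"
      using norm_one_minus_exp_Complex_le[of "-s"] s0 by simp
    also have "\<dots> \<le> s + s * \<bar>c\<bar>"
      using s0 \<open>\<bar>\<beta>\<bar> \<le> 1\<close> mult_right_mono[OF \<open>\<bar>\<beta>\<bar> \<le> 1\<close>, of "\<bar>c\<bar>"]
      by (auto simp: abs_mult abs_sgn_eq intro!: mult_left_mono)
    also have "\<dots> = (1 + \<bar>c\<bar>) * s" by (simp add: algebra_simps)
    also have "s \<le> \<sigma> powr \<alpha> * u powr \<alpha>"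
      unfolding s_def using that \<open>0 < \<alpha>\<close> by (intro mult_left_mono powr_mono2) auto
    hence "(1 + \<bar>c\<bar>) * s \<le> K" unfolding K_def
      by (simp add: mult.assoc mult_left_mono)
    finally show ?thesis .
  qed
  have integrable_norm: "integrable lborel (\<lambda>t. norm (indicator {-u..u} t *\<^sub>R (1 - char N t)))"
  proof -
    have "(\<lambda>t. norm (indicator {-u..u} t *\<^sub>R (1 - char N t)))
        = (\<lambda>t. indicator {-u..u} t *\<^sub>R cmod (1 - char N t))"
      by (auto split: split_indicator)
    moreover have "integrable lborel (\<lambda>t. indicator {-u..u} t *\<^sub>R cmod (1 - char N t))"
      by (intro borel_integrable_compact[OF compact_Icc] continuous_at_imp_continuous_on
                  continuous_intros ballI isCont_char continuous_intros)
    ultimately show ?thesis by simp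
  qed
  have "u * measure N {x. abs x \<ge> 2 / u} \<le> Re (CLBINT t:{-u..u}. 1 - char N t)"
    by (rule measure_abs_ge_le_char_integral[OF u])
  also have "\<dots> \<le> cmod (CLBINT t:{-u..u}. 1 - char N t)" by (rule complex_Re_le_cmod)
  also have "\<dots> \<le> (\<integral>t. norm (indicator {-u..u} t *\<^sub>R (1 - char N t)) \<partial>lborel)"
    unfolding set_lebesgue_integral_def by (rule integral_norm_bound)
  also have "\<dots> \<le> (\<integral>t. indicator {-u..u} t * K \<partial>lborel)"
    using one_minus_char_le
    by (intro integral_mono[OF integrable_norm]) (auto simp: emeasure_lborel_Icc_eq split: split_indicator)
  also have "\<dots> = u * (2 * K)" using u by (simp add: emeasure_lborel_Icc_eq)
  finally have "measure N {x. abs x \<ge> 2/u} \<le> 2 * K" using u by (simp add: mult_le_cancel_left_pos)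
  also have "2 * K = stable_tail_const \<alpha> * \<sigma> powr \<alpha> / t powr \<alpha>"
    unfolding K_def u_def stable_tail_const_def c_def using \<open>0 < t\<close>
    by (simp add: powr_divide powr_add field_simps)
  finally show ?thesis using \<open>0 < t\<close> by (simp add: u_def)
qed

section \<open>The discretised truncations \<open>Z_k\<close>\<close>

lemma Zq_measurable [measurable]: "Zq k \<in> borel_measurable borel"
  unfolding Zq_def Ytr_def by measurable

lemma Ytr_nonneg: "0 \<le> Ytr k x"
  unfolding Ytr_def
  by (cases "x \<in> {2 ^ k .. 4 ^ k}") (auto intro: order_trans[OF zero_le_power[of "2::real" k]])

lemma Zq_nonneg: "0 \<le> Zq k x"
  unfolding Zq_def by (intro sum_nonneg) auto

lemma Zq_le_Ytr: "Zq k x \<le> Ytr k x"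
proof -
  define y where "y = Ytr k x"
  have y0: "0 \<le> y" by (simp add: y_def Ytr_nonneg)
  define J where "J = nat \<lfloor>4 ^ k * y\<rfloor>"
  have term_le: "(real j / 4 ^ k) * indicator {real j / 4 ^ k ..< (real j + 1) / 4 ^ k} y
      \<le> (if j = J then y else 0)" for j :: nat
  proof (cases "y \<in> {real j / 4 ^ k ..< (real j + 1) / 4 ^ k}")
    case True
    hence "real j \<le> 4 ^ k * y" "4 ^ k * y < real j + 1"
      by (auto simp: field_simps)
    hence "\<lfloor>4 ^ k * y\<rfloor> = int j" by (simp add: floor_eq_iff)
    hence "j = J" by (simp add: J_def)
    thus ?thesis using True by auto
  next
    case False thus ?thesis using y0 by auto
  qed
  have "Zq k x \<le> (\<Sum>j\<in>{8 ^ k .. 16 ^ k :: nat}. (if j = J then y else 0))"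
    unfolding Zq_def y_def[symmetric] by (intro sum_mono term_le)
  also have "\<dots> \<le> y" using y0 by (simp add: sum.delta)
  finally show ?thesis by (simp add: y_def)
qed

lemma Zq_le_pow4: "Zq k x \<le> 4 ^ k"
  using Zq_le_Ytr[of k x] unfolding Ytr_def
  by (cases "x \<in> {2 ^ k .. 4 ^ k}") (auto intro: order_trans[OF _ zero_le_power[of "4::real" k]])

lemma Ytr_sq_le_dyadic_sum:
  "(Ytr k x)\<^sup>2 \<le> (\<Sum>j\<in>{k..2*k}. 4 ^ (j + 1) * indicator {2 ^ j ..} x)"
proof (cases "x \<in> {2 ^ k .. 4 ^ k}")
  case False
  thus ?thesis by (auto simp: Ytr_def intro!: sum_nonneg split: split_indicator)
next
  case True
  hence x: "2 ^ k \<le> x" "x \<le> 2 ^ (2*k)" by (auto simp: power_mult)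
  have xpos: "x > 0" using x(1) by (smt (verit) zero_less_power)
  define j where "j = nat \<lfloor>log 2 x\<rfloor>"
  have lk: "real k \<le> log 2 x" using x(1) xpos
    by (simp add: le_log_iff powr_realpow)
  have lk2: "log 2 x \<le> real (2*k)" using x(2) xpos
    by (simp add: log_le_iff powr_realpow del: of_nat_mult)
  have j_range: "k \<le> j" "j \<le> 2*k" using lk lk2 unfolding j_def
    by (simp_all add: le_nat_floor floor_le_iff nat_le_iff)
  have "real j \<le> log 2 x" unfolding j_def using lk by (simp add: of_nat_nat)
  hence x_ge: "2 ^ j \<le> x" using xpos by (simp add: le_log_iff powr_realpow)
  have "log 2 x < real (j + 1)" unfolding j_def using lk by (simp add: of_nat_nat) linarith
  hence "x < 2 powr real (j+1)" using xpos by (simp add: log_less_iff del: of_nat_add)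
  hence x_less: "x < 2 ^ (j+1)" by (simp only: powr_realpow[of 2, simplified])
  have "(Ytr k x)\<^sup>2 = x\<^sup>2" using True by (simp add: Ytr_def)
  also have "\<dots> \<le> (2 ^ (j+1))\<^sup>2" using x_less xpos by (intro power_mono) auto
  also have "\<dots> = 4 ^ (j + 1) * indicator {2 ^ j ..} x"
    using x_ge by (simp add: power_mult_distrib[symmetric] power_mult[symmetric] mult.commute)
       (metis power_mult numeral_Bit0 power2_eq_square mult_2_right power_mult_distrib)
  also have "\<dots> \<le> (\<Sum>j\<in>{k..2*k}. 4 ^ (j + 1) * indicator {2 ^ j ..} x)"
    by (rule member_le_sum[where i=j and A="{k..2*k}"]) (use j_range in \<open>auto split: split_indicator\<close>)
  finally show ?thesis .
qed

lemma sum_power_atLeastAtMost_double_le: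
  fixes r :: real
  assumes "r > 1"
  shows "(\<Sum>j\<in>{k..2*k}. r ^ j) \<le> r ^ (2*k+1) / (r - 1)"
proof -
  have "(\<Sum>j\<in>{k..2*k}. r ^ j) \<le> (\<Sum>j<2*k+1. r ^ j)"
    using assms by (intro sum_mono2) auto
  also have "\<dots> = (r ^ (2*k+1) - 1) / (r - 1)"
    using assms by (intro geometric_sum) auto
  also have "\<dots> \<le> r ^ (2*k+1) / (r - 1)"
    using assms by (simp add: divide_right_mono)
  finally show ?thesis .
qed

definition moment_ratio :: "real \<Rightarrow> real" where
  "moment_ratio \<alpha> = 4 / 2 powr \<alpha>"

lemma moment_ratio_gt_1: "\<alpha> < 2 \<Longrightarrow> moment_ratio \<alpha> > 1"
proof -
  assume "\<alpha> < 2"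
  hence "2 powr \<alpha> < 2 powr (2::real)" by (subst powr_less_cancel_iff) auto
  thus ?thesis unfolding moment_ratio_def by simp
qed

lemma stable_law_Zq_second_moment:
  assumes stable: "stable_law \<alpha> \<sigma> 1 0 N" and "0 < \<alpha>" "\<alpha> < 2"
  shows "(\<integral>x. (Zq k x)\<^sup>2 \<partial>N)
    \<le> 4 * stable_tail_const \<alpha> * \<sigma> powr \<alpha> * moment_ratio \<alpha> ^ (2*k+1) / (moment_ratio \<alpha> - 1)"
proof -
  interpret real_distribution N using stable unfolding stable_law_def by auto
  define A where "A = stable_tail_const \<alpha>"
  define r where "r = moment_ratio \<alpha>"
  define s where "s = \<sigma> powr \<alpha>"
  have "s \<ge> 0" "A \<ge> 0" by (simp_all add: s_def A_def stable_tail_const_nonneg)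
  have integrable_sq: "integrable N (\<lambda>x. (Zq k x)\<^sup>2)"
    by (rule integrable_const_bound[where B="(4^k)^2"])
       (use Zq_nonneg Zq_le_pow4 in \<open>auto intro!: power_mono\<close>)
  have integrable_tail: "integrable N (\<lambda>x. (4::real) ^ (j + 1) * indicator {2 ^ j ..} x)" for j :: nat
    by (intro integrable_mult_right integrable_real_indicator) (auto simp: emeasure_eq_measure)
  have "(\<integral>x. (Zq k x)\<^sup>2 \<partial>N) \<le> (\<integral>x. (\<Sum>j\<in>{k..2*k}. 4 ^ (j + 1) * indicator {2 ^ j ..} x) \<partial>N)"
  proof (intro integral_mono integrable_sq Bochner_Integration.integrable_sum integrable_tail)
    fix x
    have "(Zq k x)\<^sup>2 \<le> (Ytr k x)\<^sup>2"
      using Zq_nonneg Zq_le_Ytr by (intro power_mono) auto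
    thus "(Zq k x)\<^sup>2 \<le> (\<Sum>j\<in>{k..2*k}. 4 ^ (j + 1) * indicator {2 ^ j ..} x)"
      using Ytr_sq_le_dyadic_sum[of k x] by linarith
  qed
  also have "\<dots> = (\<Sum>j\<in>{k..2*k}. 4 ^ (j + 1) * measure N {2 ^ j ..})"
    by (subst Bochner_Integration.integral_sum)
       (auto intro!: integrable_tail integrable_real_indicator simp: emeasure_eq_measure)
  also have "\<dots> \<le> (\<Sum>j\<in>{k..2*k}. 4 * A * s * r ^ j)"
  proof (intro sum_mono)
    fix j
    have "measure N {2 ^ j ..} \<le> measure N {x. 2 ^ j \<le> \<bar>x\<bar>}"
      by (intro finite_measure_mono) auto
    also have "\<dots> \<le> A * s / (2 ^ j) powr \<alpha>"
      using stable_law_tail_bound[OF stable _ \<open>0 < \<alpha>\<close>, of "2^j"] by (simp add: A_def s_def)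
    finally have "4 ^ (j + 1) * measure N {2 ^ j ..} \<le> 4 ^ (j + 1) * (A * s / (2 ^ j) powr \<alpha>)"
      by (intro mult_left_mono) auto
    also have "\<dots> = 4 * A * s * r ^ j"
      unfolding r_def moment_ratio_def
      by (simp add: powr_realpow[symmetric] powr_powr power_divide powr_power mult.commute field_simps)
    finally show "4 ^ (j + 1) * measure N {2 ^ j ..} \<le> 4 * A * s * r ^ j" .
  qed
  also have "\<dots> = 4 * A * s * (\<Sum>j\<in>{k..2*k}. r ^ j)"
    by (simp add: sum_distrib_left)
  also have "\<dots> \<le> 4 * A * s * (r ^ (2*k+1) / (r - 1))"
    using \<open>s \<ge> 0\<close> \<open>A \<ge> 0\<close> moment_ratio_gt_1[OF \<open>\<alpha> < 2\<close>]
    by (intro mult_left_mono sum_power_atLeastAtMost_double_le) (auto simp: r_def)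
  finally show ?thesis by (simp add: s_def A_def r_def)
qed

section \<open>Series converging absolutely in \<open>L\<^sup>1\<close>\<close>

lemma AE_summable_abs_of_summable_integral_abs:
  fixes w :: "nat \<Rightarrow> 'a \<Rightarrow> real"
  assumes integrable: "\<And>k. integrable M (w k)"
    and summable: "summable (\<lambda>k. \<integral>x. \<bar>w k x\<bar> \<partial>M)"
  shows "AE x in M. summable (\<lambda>k. \<bar>w k x\<bar>)"
proof -
  have [measurable]: "\<And>k. w k \<in> borel_measurable M" using integrable by auto
  have "(\<integral>\<^sup>+ x. (\<Sum>k. ennreal \<bar>w k x\<bar>) \<partial>M) = (\<Sum>k. \<integral>\<^sup>+ x. ennreal \<bar>w k x\<bar> \<partial>M)"
    by (intro nn_integral_suminf) auto
  also have "\<dots> = (\<Sum>k. ennreal (\<integral>x. \<bar>w k x\<bar> \<partial>M))"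
    by (intro arg_cong[where f=suminf] ext nn_integral_eq_integral integrable_abs integrable) auto
  also have "\<dots> \<noteq> \<infinity>"
    using summable by (simp add: ennreal_suminf_neq_top integral_nonneg_AE)
  finally have "AE x in M. (\<Sum>k. ennreal \<bar>w k x\<bar>) \<noteq> \<infinity>"
    by (intro nn_integral_PInf_AE) measurable
  thus ?thesis
    by eventually_elim (metis abs_ge_zero infinity_ennreal_def summable_suminf_not_top)
qed

lemma L1_convergence_suminf:
  fixes w :: "nat \<Rightarrow> 'a \<Rightarrow> real"
  assumes integrable: "\<And>k. integrable M (w k)"
    and summable: "summable (\<lambda>k. \<integral>x. \<bar>w k x\<bar> \<partial>M)"
  shows "integrable M (\<lambda>x. \<Sum>k. w k x)"
    and "(\<lambda>K. \<integral>x. \<bar>(\<Sum>k\<le>K. w k x) - (\<Sum>k. w k x)\<bar> \<partial>M) \<longlonglongrightarrow> 0"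
    and "(\<integral>x. \<bar>\<Sum>k. w k x\<bar> \<partial>M) \<le> (\<Sum>k. \<integral>x. \<bar>w k x\<bar> \<partial>M)"
proof -
  define V where "V x = (\<Sum>k. w k x)" for x
  have summable_AE: "AE x in M. summable (\<lambda>k. \<bar>w k x\<bar>)"
    by (rule AE_summable_abs_of_summable_integral_abs[OF integrable summable])
  show integrable_V: "integrable M (\<lambda>x. \<Sum>k. w k x)"
    by (rule integrable_suminf[OF integrable]) (use summable_AE summable in auto)
  have summable_tail_AE: "AE x in M. summable (\<lambda>i. norm \<bar>w (i + K) x\<bar>)" for K
    using summable_AE by eventually_elim (drule summable_ignore_initial_segment[of _ K], simp)
  have summable_tail: "summable (\<lambda>i. \<integral>x. norm \<bar>w (i + K) x\<bar> \<partial>M)" for K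
    using summable_ignore_initial_segment[OF summable, of K] by simp
  have integrable_tail: "integrable M (\<lambda>x. \<Sum>i. \<bar>w (i + K) x\<bar>)" for K
    by (rule integrable_suminf[OF _ summable_tail_AE summable_tail]) (auto intro: integrable)
  have integral_tail: "(\<integral>x. (\<Sum>i. \<bar>w (i + K) x\<bar>) \<partial>M) = (\<Sum>i. \<integral>x. \<bar>w (i + K) x\<bar> \<partial>M)" for K
    by (rule integral_suminf[OF _ summable_tail_AE summable_tail]) (auto intro: integrable)
  have remainder_le: "(\<integral>x. \<bar>(\<Sum>k\<le>K. w k x) - V x\<bar> \<partial>M) \<le> (\<Sum>i. \<integral>x. \<bar>w (i + Suc K) x\<bar> \<partial>M)" for K
  proof -
    have "(\<integral>x. \<bar>(\<Sum>k\<le>K. w k x) - V x\<bar> \<partial>M) \<le> (\<integral>x. (\<Sum>i. \<bar>w (i + Suc K) x\<bar>) \<partial>M)"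
    proof (rule integral_mono_AE)
      show "integrable M (\<lambda>x. \<bar>(\<Sum>k\<le>K. w k x) - V x\<bar>)"
        using integrable_V integrable unfolding V_def by (intro integrable_abs Bochner_Integration.integrable_diff) auto
      show "AE x in M. \<bar>(\<Sum>k\<le>K. w k x) - V x\<bar> \<le> (\<Sum>i. \<bar>w (i + Suc K) x\<bar>)"
        using summable_AE
      proof eventually_elim
        case (elim x)
        have "V x = (\<Sum>i. w (i + Suc K) x) + (\<Sum>k\<le>K. w k x)"
          unfolding V_def lessThan_Suc_atMost[symmetric]
          by (rule suminf_split_initial_segment[OF summable_rabs_cancel[OF elim]])
        hence "\<bar>(\<Sum>k\<le>K. w k x) - V x\<bar> = \<bar>\<Sum>i. w (i + Suc K) x\<bar>" by simp
        also have "\<dots> \<le> (\<Sum>i. \<bar>w (i + Suc K) x\<bar>)"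
          by (rule summable_rabs[OF summable_ignore_initial_segment[OF elim, of "Suc K"]])
        finally show ?case .
      qed
    qed (rule integrable_tail)
    thus ?thesis by (simp only: integral_tail)
  qed
  have remainder_lim: "(\<lambda>K. \<Sum>i. \<integral>x. \<bar>w (i + Suc K) x\<bar> \<partial>M) \<longlonglongrightarrow> 0"
    by (rule LIMSEQ_Suc[OF suminf_exist_split2[OF summable]])
  show "(\<lambda>K. \<integral>x. \<bar>(\<Sum>k\<le>K. w k x) - (\<Sum>k. w k x)\<bar> \<partial>M) \<longlonglongrightarrow> 0"
    by (rule tendsto_sandwich[OF _ _ tendsto_const remainder_lim])
       (use remainder_le in \<open>auto simp: V_def intro!: always_eventually\<close>)
  have "(\<integral>x. \<bar>V x\<bar> \<partial>M) \<le> (\<integral>x. (\<Sum>i. \<bar>w (i + 0) x\<bar>) \<partial>M)"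
  proof (rule integral_mono_AE)
    show "integrable M (\<lambda>x. \<bar>V x\<bar>)" using integrable_V unfolding V_def by auto
    show "AE x in M. \<bar>V x\<bar> \<le> (\<Sum>i. \<bar>w (i + 0) x\<bar>)"
      using summable_AE by eventually_elim (simp only: add_0_right V_def, rule summable_rabs)
  qed (rule integrable_tail)
  thus "(\<integral>x. \<bar>\<Sum>k. w k x\<bar> \<partial>M) \<le> (\<Sum>k. \<integral>x. \<bar>w k x\<bar> \<partial>M)"
    using integral_tail[of 0] by (simp add: V_def)
qed

lemma sums_geometric_from:
  fixes r :: real
  assumes "0 < r" "r < 1"
  shows "(\<lambda>k. if K \<le> k then r ^ k else 0) sums (r ^ K / (1 - r))"
proof -
  have "(\<lambda>i. r ^ K * r ^ i) sums (r ^ K * (1 / (1 - r)))"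
    using assms by (intro sums_mult geometric_sums) auto
  hence "(\<lambda>i. (\<lambda>k. if K \<le> k then r ^ k else 0) (i + K)) sums (r ^ K / (1 - r))"
    by (simp add: power_add mult.commute)
  thus ?thesis by (subst (asm) sums_iff_shift) simp
qed

lemma (in prob_space) integral_abs_le_sqrt_integral_square:
  fixes W :: "'a \<Rightarrow> real"
  assumes "integrable M W" "integrable M (\<lambda>x. (W x)\<^sup>2)"
  shows "(\<integral>x. \<bar>W x\<bar> \<partial>M) \<le> sqrt (\<integral>x. (W x)\<^sup>2 \<partial>M)"
proof -
  define a where "a = (\<integral>x. \<bar>W x\<bar> \<partial>M)"
  have "0 \<le> (\<integral>x. (\<bar>W x\<bar> - a)\<^sup>2 \<partial>M)" by simp
  also have "(\<lambda>x. (\<bar>W x\<bar> - a)\<^sup>2) = (\<lambda>x. (W x)\<^sup>2 - 2 * a * \<bar>W x\<bar> + a\<^sup>2)"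
    by (auto simp: power2_eq_square algebra_simps)
  also have "(\<integral>x. (W x)\<^sup>2 - 2 * a * \<bar>W x\<bar> + a\<^sup>2 \<partial>M) = (\<integral>x. (W x)\<^sup>2 \<partial>M) - a\<^sup>2"
    using assms by (simp add: a_def prob_space power2_eq_square)
  finally have "sqrt (a\<^sup>2) \<le> sqrt (\<integral>x. (W x)\<^sup>2 \<partial>M)" by (intro real_sqrt_le_mono) simp
  thus ?thesis by (simp add: a_def)
qed

lemma (in prob_space) integral_square_orthogonal_sum:
  fixes U :: "nat \<Rightarrow> 'a \<Rightarrow> real" and c :: "nat \<Rightarrow> real"
  assumes "finite S"
    and measurable: "\<And>m. m \<in> S \<Longrightarrow> U m \<in> borel_measurable M"
    and bounded: "\<And>m \<omega>. m \<in> S \<Longrightarrow> \<omega> \<in> space M \<Longrightarrow> \<bar>U m \<omega>\<bar> \<le> B"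
    and orthogonal: "\<And>m m'. m \<in> S \<Longrightarrow> m' \<in> S \<Longrightarrow> m \<noteq> m' \<Longrightarrow> (\<integral>\<omega>. U m \<omega> * U m' \<omega> \<partial>M) = 0"
  shows "(\<integral>\<omega>. (\<Sum>m\<in>S. c m * U m \<omega>)\<^sup>2 \<partial>M) = (\<Sum>m\<in>S. (c m)\<^sup>2 * (\<integral>\<omega>. (U m \<omega>)\<^sup>2 \<partial>M))"
proof -
  have integrable_product: "integrable M (\<lambda>\<omega>. U m \<omega> * U m' \<omega>)" if "m \<in> S" "m' \<in> S" for m m'
    using that measurable bounded
    by (intro integrable_const_bound[where B="B * B"] AE_I2) (auto simp: abs_mult intro!: mult_mono')
  have "(\<lambda>\<omega>. (\<Sum>m\<in>S. c m * U m \<omega>)\<^sup>2) = (\<lambda>\<omega>. \<Sum>m\<in>S. \<Sum>m'\<in>S. (c m * c m') * (U m \<omega> * U m' \<omega>))"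
    by (auto simp: power2_eq_square sum_product algebra_simps)
  hence "(\<integral>\<omega>. (\<Sum>m\<in>S. c m * U m \<omega>)\<^sup>2 \<partial>M)
      = (\<Sum>m\<in>S. \<Sum>m'\<in>S. (c m * c m') * (\<integral>\<omega>. U m \<omega> * U m' \<omega> \<partial>M))"
    using integrable_product by (simp add: Bochner_Integration.integral_sum Bochner_Integration.integrable_sum)
  also have "\<dots> = (\<Sum>m\<in>S. \<Sum>m'\<in>S. (if m' = m then (c m)\<^sup>2 * (\<integral>\<omega>. (U m \<omega>)\<^sup>2 \<partial>M) else 0))"
    by (intro sum.cong refl) (auto simp: orthogonal power2_eq_square)
  also have "\<dots> = (\<Sum>m\<in>S. (c m)\<^sup>2 * (\<integral>\<omega>. (U m \<omega>)\<^sup>2 \<partial>M))"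
    using \<open>finite S\<close> by (simp add: sum.delta)
  finally show ?thesis .
qed

lemma (in prob_space) measure_abs_gt_tendsto_0_of_L1:
  fixes Y :: "nat \<Rightarrow> 'a \<Rightarrow> real"
  assumes integrable: "\<forall>\<^sub>F n in sequentially. integrable M (Y n)"
    and L1: "(\<lambda>n. \<integral>x. \<bar>Y n x\<bar> \<partial>M) \<longlonglongrightarrow> 0" and "\<epsilon> > 0"
  shows "(\<lambda>n. measure M {x \<in> space M. \<bar>Y n x\<bar> > \<epsilon>}) \<longlonglongrightarrow> 0"
proof (rule tendsto_sandwich[OF _ _ tendsto_const])
  show "(\<lambda>n. (\<integral>x. \<bar>Y n x\<bar> \<partial>M) / \<epsilon>) \<longlonglongrightarrow> 0"
    using tendsto_divide_zero[OF L1] .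
  show "\<forall>\<^sub>F n in sequentially. measure M {x \<in> space M. \<bar>Y n x\<bar> > \<epsilon>} \<le> (\<integral>x. \<bar>Y n x\<bar> \<partial>M) / \<epsilon>"
    using integrable
  proof eventually_elim
    case (elim n)
    have "measure M {x \<in> space M. \<bar>Y n x\<bar> > \<epsilon>} \<le> measure M {x \<in> space M. \<epsilon> \<le> \<bar>Y n x\<bar>}"
      using elim by (intro finite_measure_mono) auto
    also have "\<dots> \<le> (\<integral>x. \<bar>Y n x\<bar> \<partial>M) / \<epsilon>"
      by (rule integral_Markov_inequality_measure[OF _ sets.top]) (use elim \<open>\<epsilon> > 0\<close> in auto)
    finally show ?case .
  qed
qed simp

section \<open>Counting moving windows\<close>

definition window_count :: "nat \<Rightarrow> nat \<Rightarrow> nat \<Rightarrow> nat" where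
  "window_count n D m = card {i. i < n \<and> i \<le> m \<and> m < i + D}"

lemma window_count_le: "window_count n D m \<le> n"
proof -
  have "window_count n D m \<le> card {..<n}" unfolding window_count_def by (intro card_mono) auto
  thus ?thesis by simp
qed

lemma sum_moving_windows:
  fixes g :: "nat \<Rightarrow> real"
  shows "(\<Sum>i<n. \<Sum>j<D. g (i + j)) = (\<Sum>m<n+D. real (window_count n D m) * g m)"
proof -
  have window: "(\<Sum>j<D. g (i + j)) = (\<Sum>m<n+D. (if i \<le> m \<and> m < i + D then g m else 0))"
    if "i < n" for i
  proof -
    have "(\<Sum>j<D. g (i + j)) = (\<Sum>m\<in>{i..<i+D}. g m)"
      using sum.shift_bounds_nat_ivl[of g 0 i D] by (simp add: lessThan_atLeast0 add.commute)
    also have "\<dots> = (\<Sum>m\<in>{..<n+D} \<inter> {m. i \<le> m \<and> m < i + D}. g m)"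
      using that by (intro sum.cong) auto
    finally show ?thesis by (simp add: sum.inter_restrict)
  qed
  have "(\<Sum>i<n. \<Sum>j<D. g (i + j)) = (\<Sum>i<n. \<Sum>m<n+D. (if i \<le> m \<and> m < i + D then g m else 0))"
    by (intro sum.cong refl window) auto
  also have "\<dots> = (\<Sum>m<n+D. \<Sum>i<n. (if i \<le> m \<and> m < i + D then g m else 0))"
    by (rule sum.swap)
  also have "\<dots> = (\<Sum>m<n+D. real (window_count n D m) * g m)"
  proof (intro sum.cong refl)
    fix m
    have "(\<Sum>i<n. (if i \<le> m \<and> m < i + D then g m else 0))
        = (\<Sum>i\<in>{..<n} \<inter> {i. i \<le> m \<and> m < i + D}. g m)"
      by (subst sum.inter_restrict) auto
    also have "{..<n} \<inter> {i. i \<le> m \<and> m < i + D} = {i. i < n \<and> i \<le> m \<and> m < i + D}" by auto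
    finally show "(\<Sum>i<n. (if i \<le> m \<and> m < i + D then g m else 0)) = real (window_count n D m) * g m"
      by (simp add: window_count_def)
  qed
  finally show ?thesis .
qed

lemma sum_window_count: "(\<Sum>m<n+D. real (window_count n D m)) = real n * real D"
  using sum_moving_windows[where g="\<lambda>_. 1" and n=n and D=D] by simp

lemma sum_window_count_div_sq_le:
  assumes "D > 0"
  shows "(\<Sum>m<n+D. (real (window_count n D m) / real D)\<^sup>2) \<le> (real n)\<^sup>2 / real D"
proof -
  have "(\<Sum>m<n+D. (real (window_count n D m) / real D)\<^sup>2)
      \<le> (\<Sum>m<n+D. (real n / real D) * (real (window_count n D m) / real D))"
    using window_count_le assms
    by (intro sum_mono) (auto simp: power2_eq_square intro!: mult_right_mono divide_right_mono)
  also have "\<dots> = (real n / real D) * ((\<Sum>m<n+D. real (window_count n D m)) / real D)"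
    by (simp add: sum_distrib_left sum_divide_distrib)
  also have "\<dots> = (real n)\<^sup>2 / real D" using assms by (simp add: sum_window_count power2_eq_square)
  finally show ?thesis .
qed

section \<open>Measure preserving maps\<close>

lemma measurable_funpow: "T \<in> M \<rightarrow>\<^sub>M M \<Longrightarrow> (T ^^ j) \<in> M \<rightarrow>\<^sub>M M"
  by (induction j) (auto intro: measurable_compose)

lemma distr_funpow_eq:
  assumes T: "T \<in> M \<rightarrow>\<^sub>M M" and preserving: "distr M M T = M"
  shows "distr M M (T ^^ j) = M"
proof (induction j)
  case 0 thus ?case by (simp add: distr_id[unfolded id_def])
next
  case (Suc j)
  have "distr M M (T ^^ Suc j) = distr M M ((T ^^ j) \<circ> T)" by (simp only: funpow_Suc_right)
  also have "\<dots> = distr (distr M M T) M (T ^^ j)"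
    by (rule distr_distr[symmetric, OF measurable_funpow[OF T] T])
  finally show ?case by (simp only: preserving Suc)
qed

lemma
  fixes g :: "_ \<Rightarrow> real"
  assumes T: "T \<in> M \<rightarrow>\<^sub>M M" and preserving: "distr M M T = M" and g: "g \<in> borel_measurable M"
  shows integral_funpow_eq: "(\<integral>x. g ((T ^^ j) x) \<partial>M) = (\<integral>x. g x \<partial>M)"
    and integrable_funpow_iff: "integrable M (\<lambda>x. g ((T ^^ j) x)) \<longleftrightarrow> integrable M g"
  using integral_distr[OF measurable_funpow[OF T] g, of j]
    integrable_distr_eq[OF measurable_funpow[OF T] g, of j]
  by (simp_all add: distr_funpow_eq[OF T preserving])

lemma ergodic_aperiodic_ppsD:
  assumes "ergodic_aperiodic_pps M T"
  shows "prob_space M" "T \<in> M \<rightarrow>\<^sub>M M" "distr M M T = M"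
  using assms unfolding ergodic_aperiodic_pps_def by auto

section \<open>The block lengths \<open>D_k\<close>\<close>

lemma
  assumes "1 < \<alpha>" "k \<ge> 1"
  shows Dk_ge_1: "Dk \<alpha> k \<ge> 1" and Dk_ge_half: "real (Dk \<alpha> k) \<ge> 4 powr (\<alpha> * real k) / 2"
proof -
  have "4 powr (\<alpha> * real k) \<ge> 4 powr 1"
    using assms mult_mono[of 1 \<alpha> 1 "real k"] by (intro powr_mono) auto
  hence ge_4: "4 powr (\<alpha> * real k) \<ge> 4" by simp
  hence floor_ge: "\<lfloor>4 powr (\<alpha> * real k)\<rfloor> \<ge> 4" by (simp add: le_floor_iff)
  thus "Dk \<alpha> k \<ge> 1" unfolding Dk_def by linarith
  have "real (Dk \<alpha> k) = real_of_int \<lfloor>4 powr (\<alpha> * real k)\<rfloor>" using floor_ge by (simp add: Dk_def)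
  thus "real (Dk \<alpha> k) \<ge> 4 powr (\<alpha> * real k) / 2" using ge_4 by linarith
qed

lemma Dk_le_dk:
  assumes "\<alpha> < 2" "k \<ge> 2"
  shows "Dk \<alpha> k \<le> dk k"
proof -
  have "4 powr (\<alpha> * real k) \<le> 4 powr (real (k^2))"
    using assms by (intro powr_mono) (auto simp: power2_eq_square intro!: mult_right_mono)
  also have "\<dots> = real (dk k)" using powr_realpow[of 4 "k^2"] by (simp add: dk_def)
  finally have "real_of_int \<lfloor>4 powr (\<alpha> * real k)\<rfloor> \<le> real (dk k)" by linarith
  thus ?thesis unfolding Dk_def by (simp add: nat_le_iff)
qed

lemma le_Dk_if_log_less:
  assumes "log 2 (real n) / (2 * \<alpha>) < real k" "n \<ge> 1" "\<alpha> > 0"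
  shows "n \<le> Dk \<alpha> k"
proof -
  have "log 2 (real n) < 2 * \<alpha> * real k" using assms by (simp add: divide_less_eq mult.commute)
  hence "real n < 2 powr (2 * \<alpha> * real k)" using assms by (simp add: log_less_iff)
  also have "2 powr (2 * \<alpha> * real k) = 4 powr (\<alpha> * real k)"
    by (simp add: powr_powr[symmetric] mult.assoc)
  finally have "int n \<le> \<lfloor>4 powr (\<alpha> * real k)\<rfloor>" by (intro le_floor_iff[THEN iffD2]) simp
  thus ?thesis unfolding Dk_def by (simp add: le_nat_iff)
qed

lemma moment_ratio_power_div:
  "moment_ratio \<alpha> ^ (2 * k) / 4 powr (\<alpha> * real k) = (4 powr (1 - \<alpha>)) ^ (2 * k)"
proof -
  have ratio: "moment_ratio \<alpha> ^ (2 * k) = 2 powr (real (4 * k) - 2 * \<alpha> * real k)"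
  proof -
    have "moment_ratio \<alpha> = 2 powr (2 - \<alpha>)"
      by (simp add: moment_ratio_def powr_diff)
    hence "moment_ratio \<alpha> ^ (2 * k) = 2 powr (real (2 * k) * (2 - \<alpha>))"
      by (simp only: powr_power[of 2])
    thus ?thesis by (simp add: algebra_simps)
  qed
  have denominator: "4 powr (\<alpha> * real k) = 2 powr (2 * \<alpha> * real k)"
  proof -
    have "4 powr (\<alpha> * real k) = (2 powr 2) powr (\<alpha> * real k)" by simp
    also have "\<dots> = 2 powr (2 * (\<alpha> * real k))" by (simp only: powr_powr)
    finally show ?thesis by (simp add: mult.assoc)
  qed
  have rate: "(4 powr (1 - \<alpha>)) ^ (2 * k) = 2 powr (real (4 * k) - 4 * \<alpha> * real k)"
  proof -
    have "(4 powr (1 - \<alpha>)) ^ (2 * k) = 4 powr (real (2 * k) * (1 - \<alpha>))"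
      by (simp only: powr_power[of 4])
    also have "\<dots> = 4 powr ((1 - \<alpha>) * real (2 * k))" by (simp add: mult.commute)
    also have "\<dots> = (2 powr 2) powr ((1 - \<alpha>) * real (2 * k))" by simp
    also have "\<dots> = 2 powr (2 * ((1 - \<alpha>) * real (2 * k)))"
      by (simp only: powr_powr)
    finally show ?thesis by (simp add: algebra_simps)
  qed
  show ?thesis unfolding ratio denominator rate by (simp add: powr_diff[symmetric] algebra_simps)
qed

section \<open>Transfer to the triangular array\<close>

definition orbit_vector :: "('a \<Rightarrow> 'a) \<Rightarrow> (nat \<Rightarrow> 'a \<Rightarrow> real) \<Rightarrow> 'a \<Rightarrow> nat \<times> nat \<Rightarrow> real" where
  "orbit_vector T f x = (\<lambda>i\<in>adm_index. f (fst i) ((T ^^ snd i) x))"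

definition array_vector :: "(nat \<Rightarrow> nat \<Rightarrow> 'b \<Rightarrow> real) \<Rightarrow> 'b \<Rightarrow> nat \<times> nat \<Rightarrow> real" where
  "array_vector X \<omega> = (\<lambda>i\<in>adm_index. Zq (fst i) (X (fst i) (snd i + 1) \<omega>))"

locale admissible_setting =
  fixes M :: "'a measure" and T :: "'a \<Rightarrow> 'a"
    and P :: "'b measure" and X :: "nat \<Rightarrow> nat \<Rightarrow> 'b \<Rightarrow> real"
    and f :: "nat \<Rightarrow> 'a \<Rightarrow> real" and \<alpha> :: real
  assumes alpha_gt_1: "1 < \<alpha>" and alpha_lt_2: "\<alpha> < 2"
    and pps: "ergodic_aperiodic_pps M T"
    and array: "triangular_array \<alpha> P X"
    and admissible: "admissible_system M T P X f"
begin

sublocale M: prob_space M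
  using ergodic_aperiodic_ppsD(1)[OF pps] .

sublocale P: prob_space P
  using array unfolding triangular_array_def by auto

lemma X_indep: "P.indep_vars (\<lambda>_. borel) (\<lambda>(k, m). X k m) {(k, m). k \<ge> 1 \<and> m \<ge> 1}"
  using array unfolding triangular_array_def by auto

lemma X_measurable: "k \<ge> 1 \<Longrightarrow> m \<ge> 1 \<Longrightarrow> X k m \<in> borel_measurable P"
  using X_indep unfolding P.indep_vars_def by auto

lemma X_stable: "k \<ge> 1 \<Longrightarrow> m \<ge> 1 \<Longrightarrow> stable_law \<alpha> (real k powr (-1 / \<alpha>)) 1 0 (distr P borel (X k m))"
  using array unfolding triangular_array_def by auto

lemma Z_measurable: "k \<ge> 1 \<Longrightarrow> m \<ge> 1 \<Longrightarrow> (\<lambda>\<omega>. Zq k (X k m \<omega>)) \<in> borel_measurable P"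
  using measurable_comp[OF X_measurable Zq_measurable, unfolded comp_def] by blast

lemma Z_integrable: "k \<ge> 1 \<Longrightarrow> m \<ge> 1 \<Longrightarrow> integrable P (\<lambda>\<omega>. Zq k (X k m \<omega>))"
  by (rule P.integrable_const_bound[where B="4^k"]) (use Z_measurable Zq_nonneg Zq_le_pow4 in auto)

lemma f_measurable: "k \<ge> 1 \<Longrightarrow> f k \<in> borel_measurable M"
  using admissible unfolding admissible_system_def by auto

lemmas f_integral_funpow = integral_funpow_eq[OF ergodic_aperiodic_ppsD(2,3)[OF pps] f_measurable]
lemmas f_integrable_funpow_iff = integrable_funpow_iff[OF ergodic_aperiodic_ppsD(2,3)[OF pps] f_measurable]

lemma orbit_vector_measurable: "orbit_vector T f \<in> M \<rightarrow>\<^sub>M PiM adm_index (\<lambda>_. borel)"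
  unfolding orbit_vector_def
proof (rule measurable_restrict)
  fix i assume "i \<in> adm_index"
  hence "fst i \<ge> 1" by (auto simp: adm_index_def)
  thus "(\<lambda>x. f (fst i) ((T ^^ snd i) x)) \<in> borel_measurable M"
    using measurable_comp[OF measurable_funpow[OF ergodic_aperiodic_ppsD(2)[OF pps]] f_measurable]
    by (simp add: comp_def)
qed

lemma array_vector_measurable: "array_vector X \<in> P \<rightarrow>\<^sub>M PiM adm_index (\<lambda>_. borel)"
  unfolding array_vector_def
  by (rule measurable_restrict) (auto simp: adm_index_def intro!: Z_measurable)

lemma
  fixes g :: "(nat \<times> nat \<Rightarrow> real) \<Rightarrow> real"
  assumes g: "g \<in> borel_measurable (PiM adm_index (\<lambda>_. borel))"
  shows integral_orbit_vector_eq: "(\<integral>x. g (orbit_vector T f x) \<partial>M) = (\<integral>\<omega>. g (array_vector X \<omega>) \<partial>P)"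
    and integrable_orbit_vector_iff:
      "integrable M (\<lambda>x. g (orbit_vector T f x)) \<longleftrightarrow> integrable P (\<lambda>\<omega>. g (array_vector X \<omega>))"
proof -
  have same_law: "distr M (PiM adm_index (\<lambda>_. borel)) (orbit_vector T f)
      = distr P (PiM adm_index (\<lambda>_. borel)) (array_vector X)"
    using admissible unfolding admissible_system_def orbit_vector_def array_vector_def by auto
  show "(\<integral>x. g (orbit_vector T f x) \<partial>M) = (\<integral>\<omega>. g (array_vector X \<omega>) \<partial>P)"
    using integral_distr[OF orbit_vector_measurable g] integral_distr[OF array_vector_measurable g]
      same_law by simp
  show "integrable M (\<lambda>x. g (orbit_vector T f x)) \<longleftrightarrow> integrable P (\<lambda>\<omega>. g (array_vector X \<omega>))"
    using integrable_distr_eq[OF orbit_vector_measurable g] integrable_distr_eq[OF array_vector_measurable g]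
      same_law by simp
qed

lemma adm_index_iff: "(k, m) \<in> adm_index \<longleftrightarrow> k \<ge> 1 \<and> m < 2 * dk k"
  by (simp add: adm_index_def)

lemma f_integrable: "k \<ge> 1 \<Longrightarrow> integrable M (f k)"
proof -
  assume "k \<ge> 1"
  hence index: "(k, 0) \<in> adm_index" by (simp add: adm_index_iff dk_def)
  have "integrable M (\<lambda>x. orbit_vector T f x (k, 0))"
    using integrable_orbit_vector_iff[OF measurable_component_singleton[OF index]]
      Z_integrable[OF \<open>k \<ge> 1\<close>, of 1]
    by (simp add: index orbit_vector_def array_vector_def)
  thus ?thesis using index by (simp add: orbit_vector_def)
qed

lemma f_funpow_integrable: "k \<ge> 1 \<Longrightarrow> integrable M (\<lambda>x. f k ((T ^^ j) x))"
  using f_integrable_funpow_iff f_integrable by blast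

definition f_mean :: "nat \<Rightarrow> real" where
  "f_mean k = (\<integral>x. f k x \<partial>M)"

lemma integral_Z_eq_f_mean:
  assumes "(k, m) \<in> adm_index"
  shows "(\<integral>\<omega>. Zq k (X k (m + 1) \<omega>) \<partial>P) = f_mean k"
  using integral_orbit_vector_eq[OF measurable_component_singleton[OF assms]] assms
    f_integral_funpow[of k m]
  by (simp add: orbit_vector_def array_vector_def f_mean_def adm_index_iff)

lemma integral_centered_Z_orthogonal:
  assumes "(k, m) \<in> adm_index" "(k, m') \<in> adm_index" "m \<noteq> m'"
  shows "(\<integral>\<omega>. (Zq k (X k (m + 1) \<omega>) - f_mean k) * (Zq k (X k (m' + 1) \<omega>) - f_mean k) \<partial>P) = 0"
proof -
  have k: "k \<ge> 1" using assms by (simp add: adm_index_iff)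
  define Y where "Y j v = Zq k (v (k, j + 1)) - f_mean k" for j and v :: "nat \<times> nat \<Rightarrow> real"
  have Y_measurable: "Y j \<in> borel_measurable (PiM {(k, j + 1)} (\<lambda>_. borel))" for j
    unfolding Y_def by measurable
  define X' where "X' = (\<lambda>(k, m). X k m)"
  have "P.indep_var (PiM {(k, m+1)} (\<lambda>_. borel)) (\<lambda>\<omega>. restrict (\<lambda>i. X' i \<omega>) {(k, m+1)})
      (PiM {(k, m'+1)} (\<lambda>_. borel)) (\<lambda>\<omega>. restrict (\<lambda>i. X' i \<omega>) {(k, m'+1)})"
    by (rule P.indep_var_restrict[OF X_indep[folded X'_def]]) (use k assms(3) in auto)
  from P.indep_var_compose[OF this Y_measurable Y_measurable]
  have "P.indep_var borel (\<lambda>\<omega>. Zq k (X k (m + 1) \<omega>) - f_mean k) borel (\<lambda>\<omega>. Zq k (X k (m' + 1) \<omega>) - f_mean k)"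
    by (simp add: Y_def X'_def comp_def)
  moreover have integrable: "integrable P (\<lambda>\<omega>. Zq k (X k (j + 1) \<omega>) - f_mean k)" for j
    using Z_integrable[OF k, of "j + 1"] by auto
  moreover have "(\<integral>\<omega>. Zq k (X k (m + 1) \<omega>) - f_mean k \<partial>P) = 0"
    using Z_integrable[OF k, of "m + 1"] integral_Z_eq_f_mean[OF assms(1)] by (simp add: P.prob_space)
  ultimately show ?thesis
    using P.indep_var_lebesgue_integral[OF _ integrable integrable] by simp
qed

definition Z_moment_bound :: "nat \<Rightarrow> real" where
  "Z_moment_bound k = 4 * stable_tail_const \<alpha> * (real k powr (-1 / \<alpha>)) powr \<alpha>
     * moment_ratio \<alpha> ^ (2*k+1) / (moment_ratio \<alpha> - 1)"

lemma integral_centered_Z_square_le: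
  assumes "(k, m) \<in> adm_index"
  shows "(\<integral>\<omega>. (Zq k (X k (m + 1) \<omega>) - f_mean k)\<^sup>2 \<partial>P) \<le> Z_moment_bound k"
proof -
  have k: "k \<ge> 1" using assms by (simp add: adm_index_iff)
  define Z where "Z \<omega> = Zq k (X k (m + 1) \<omega>)" for \<omega>
  have Z_sq_integrable: "integrable P (\<lambda>\<omega>. (Z \<omega>)\<^sup>2)"
    by (rule P.integrable_const_bound[where B="(4^k)^2"])
       (use Z_measurable[OF k] Zq_nonneg Zq_le_pow4 in \<open>auto simp: Z_def intro!: power_mono\<close>)
  have "(\<integral>\<omega>. (Z \<omega> - f_mean k)\<^sup>2 \<partial>P) = (\<integral>\<omega>. (Z \<omega>)\<^sup>2 - 2 * f_mean k * Z \<omega> + (f_mean k)\<^sup>2 \<partial>P)"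
    by (simp add: power2_eq_square algebra_simps)
  also have "\<dots> = (\<integral>\<omega>. (Z \<omega>)\<^sup>2 \<partial>P) - (f_mean k)\<^sup>2"
    using Z_integrable[OF k, of "m + 1"] Z_sq_integrable integral_Z_eq_f_mean[OF assms]
    by (simp add: Z_def P.prob_space power2_eq_square)
  also have "\<dots> \<le> (\<integral>x. (Zq k x)\<^sup>2 \<partial>(distr P borel (X k (m + 1))))"
    unfolding Z_def using X_measurable[OF k] by (subst integral_distr) auto
  also have "\<dots> \<le> Z_moment_bound k"
    unfolding Z_moment_bound_def
    by (rule stable_law_Zq_second_moment[OF X_stable[OF k]]) (use alpha_gt_1 alpha_lt_2 in auto)
  finally show ?thesis by (simp add: Z_def)
qed

lemma integral_weighted_orbit_sum_square:
  fixes c :: "nat \<Rightarrow> real"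
  assumes k: "k \<ge> 1" and N: "N \<le> 2 * dk k"
  defines "W x \<equiv> \<Sum>m<N. c m * (f k ((T ^^ m) x) - f_mean k)"
  shows "integrable M (\<lambda>x. (W x)\<^sup>2)"
    and "(\<integral>x. (W x)\<^sup>2 \<partial>M) \<le> (\<Sum>m<N. (c m)\<^sup>2) * Z_moment_bound k"
proof -
  have index: "(k, m) \<in> adm_index" if "m < N" for m
    using that N k by (simp add: adm_index_iff)
  define g where "g v = (\<Sum>m<N. c m * (v (k, m) - f_mean k))\<^sup>2" for v :: "nat \<times> nat \<Rightarrow> real"
  have g_measurable: "g \<in> borel_measurable (PiM adm_index (\<lambda>_. borel))"
    unfolding g_def using index by (intro borel_measurable_power borel_measurable_sum) auto
  define U where "U m = (\<lambda>\<omega>. Zq k (X k (m + 1) \<omega>) - f_mean k)" for m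
  have g_orbit: "g (orbit_vector T f x) = (W x)\<^sup>2" for x
    unfolding g_def W_def orbit_vector_def by (simp add: index)
  have g_array: "g (array_vector X \<omega>) = (\<Sum>m<N. c m * U m \<omega>)\<^sup>2" for \<omega>
    unfolding g_def array_vector_def U_def by (simp add: index)
  have U_measurable: "U m \<in> borel_measurable P" for m
    unfolding U_def using Z_measurable[OF k, of "m + 1"] by simp
  have U_bounded: "\<bar>U m \<omega>\<bar> \<le> 4 ^ k + \<bar>f_mean k\<bar>" for m \<omega>
    using Zq_nonneg[of k "X k (m + 1) \<omega>"] Zq_le_pow4[of k "X k (m + 1) \<omega>"] by (simp add: U_def)
  have "\<bar>\<Sum>m<N. c m * U m \<omega>\<bar>\<^sup>2 \<le> (\<Sum>m<N. \<bar>c m\<bar> * (4 ^ k + \<bar>f_mean k\<bar>))\<^sup>2" for \<omega>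
    using U_bounded
    by (intro power_mono order_trans[OF sum_abs] sum_mono) (auto simp: abs_mult intro!: mult_left_mono)
  hence "integrable P (\<lambda>\<omega>. g (array_vector X \<omega>))"
    unfolding g_array using U_measurable
    by (intro P.integrable_const_bound[where B="(\<Sum>m<N. \<bar>c m\<bar> * (4 ^ k + \<bar>f_mean k\<bar>))\<^sup>2"] AE_I2)
       auto
  thus "integrable M (\<lambda>x. (W x)\<^sup>2)"
    using integrable_orbit_vector_iff[OF g_measurable] unfolding g_orbit by simp
  have "(\<integral>x. (W x)\<^sup>2 \<partial>M) = (\<integral>\<omega>. (\<Sum>m<N. c m * U m \<omega>)\<^sup>2 \<partial>P)"
    using integral_orbit_vector_eq[OF g_measurable] unfolding g_orbit g_array .
  also have "\<dots> = (\<Sum>m<N. (c m)\<^sup>2 * (\<integral>\<omega>. (U m \<omega>)\<^sup>2 \<partial>P))"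
    using U_measurable U_bounded integral_centered_Z_orthogonal index
    by (intro P.integral_square_orthogonal_sum) (auto simp: U_def)
  also have "\<dots> \<le> (\<Sum>m<N. (c m)\<^sup>2 * Z_moment_bound k)"
    using integral_centered_Z_square_le index by (intro sum_mono mult_left_mono) (auto simp: U_def)
  finally show "(\<integral>x. (W x)\<^sup>2 \<partial>M) \<le> (\<Sum>m<N. (c m)\<^sup>2) * Z_moment_bound k"
    by (simp add: sum_distrib_right)
qed

end

section \<open>Birkhoff sums of the moving averages \<open>\<phi>_k\<close>\<close>

context admissible_setting
begin

definition centered_birkhoff :: "nat \<Rightarrow> nat \<Rightarrow> 'a \<Rightarrow> real" where
  "centered_birkhoff n k = birkhoff_sum T n (\<lambda>y. phik \<alpha> T f k y - (\<integral>z. phik \<alpha> T f k z \<partial>M))"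

lemma integral_phik: "k \<ge> 1 \<Longrightarrow> (\<integral>z. phik \<alpha> T f k z \<partial>M) = f_mean k"
  using Dk_ge_1[OF alpha_gt_1, of k] f_funpow_integrable[of k]
  by (simp add: phik_def f_integral_funpow f_mean_def)

lemma centered_birkhoff_eq_weighted_sum:
  assumes "k \<ge> 1"
  shows "centered_birkhoff n k x = (\<Sum>m<n + Dk \<alpha> k.
      (real (window_count n (Dk \<alpha> k) m) / real (Dk \<alpha> k)) * (f k ((T ^^ m) x) - f_mean k))"
proof -
  define D where "D = Dk \<alpha> k"
  have "real D > 0" using Dk_ge_1[OF alpha_gt_1 assms] by (simp add: D_def)
  have window: "phik \<alpha> T f k ((T ^^ i) x) - f_mean k
      = (\<Sum>j<D. (1 / real D) * (f k ((T ^^ (i + j)) x) - f_mean k))" for i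
  proof -
    have "(\<Sum>j<D. (1 / real D) * (f k ((T ^^ (i + j)) x) - f_mean k))
        = (1 / real D) * (\<Sum>j<D. f k ((T ^^ (i + j)) x)) - f_mean k"
      using \<open>real D > 0\<close>
      by (simp add: sum_distrib_left[symmetric] sum_subtractf right_diff_distrib
          sum_divide_distrib[symmetric])
    also have "(\<Sum>j<D. f k ((T ^^ (i + j)) x)) = (\<Sum>j<D. f k ((T ^^ j) ((T ^^ i) x)))"
      by (intro sum.cong refl) (simp add: funpow_add add.commute)
    finally show ?thesis by (simp add: phik_def D_def)
  qed
  have "centered_birkhoff n k x = (\<Sum>i<n. \<Sum>j<D. (1 / real D) * (f k ((T ^^ (i + j)) x) - f_mean k))"
    unfolding centered_birkhoff_def birkhoff_sum_def integral_phik[OF assms] window ..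
  also have "\<dots> = (\<Sum>m<n + D. real (window_count n D m) * ((1 / real D) * (f k ((T ^^ m) x) - f_mean k)))"
    by (rule sum_moving_windows)
  finally show ?thesis by (simp add: D_def field_simps)
qed

lemma integrable_centered_birkhoff:
  assumes "k \<ge> 1"
  shows "integrable M (centered_birkhoff n k)"
proof -
  have "centered_birkhoff n k = (\<lambda>x. \<Sum>m<n + Dk \<alpha> k.
      (real (window_count n (Dk \<alpha> k) m) / real (Dk \<alpha> k)) * (f k ((T ^^ m) x) - f_mean k))"
    using centered_birkhoff_eq_weighted_sum[OF assms] by blast
  thus ?thesis
    by (simp only:) (intro Bochner_Integration.integrable_sum integrable_mult_right
        Bochner_Integration.integrable_diff f_funpow_integrable[OF assms] M.integrable_const)
qed

lemma centered_birkhoff_L2: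
  assumes "k \<ge> 2" and "n \<le> Dk \<alpha> k"
  shows "integrable M (\<lambda>x. (centered_birkhoff n k x)\<^sup>2)"
    and "(\<integral>x. (centered_birkhoff n k x)\<^sup>2 \<partial>M) \<le> (real n)\<^sup>2 / real (Dk \<alpha> k) * Z_moment_bound k"
proof -
  define D where "D = Dk \<alpha> k"
  have "k \<ge> 1" "D \<ge> 1" using assms Dk_ge_1[OF alpha_gt_1, of k] by (auto simp: D_def)
  have "n + D \<le> 2 * dk k" using Dk_le_dk[OF alpha_lt_2 \<open>k \<ge> 2\<close>] assms by (simp add: D_def)
  note weighted = integral_weighted_orbit_sum_square[OF \<open>k \<ge> 1\<close> this,
      of "\<lambda>m. real (window_count n D m) / real D", folded D_def]
  show "integrable M (\<lambda>x. (centered_birkhoff n k x)\<^sup>2)"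
    using weighted(1) by (simp add: centered_birkhoff_eq_weighted_sum[OF \<open>k \<ge> 1\<close>] D_def)
  have "0 \<le> Z_moment_bound k"
    unfolding Z_moment_bound_def using moment_ratio_gt_1[OF alpha_lt_2] stable_tail_const_nonneg[of \<alpha>]
    by (intro divide_nonneg_pos mult_nonneg_nonneg zero_le_power) auto
  moreover have "(\<Sum>m<n + D. (real (window_count n D m) / real D)\<^sup>2) \<le> (real n)\<^sup>2 / real D"
    using sum_window_count_div_sq_le[of D n] \<open>D \<ge> 1\<close> by simp
  ultimately show "(\<integral>x. (centered_birkhoff n k x)\<^sup>2 \<partial>M) \<le> (real n)\<^sup>2 / real (Dk \<alpha> k) * Z_moment_bound k"
    unfolding centered_birkhoff_eq_weighted_sum[OF \<open>k \<ge> 1\<close>, folded D_def] D_def[symmetric]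
    using order_trans[OF weighted(2) mult_right_mono] by blast
qed

definition decay_rate :: real where
  "decay_rate = 4 powr (1 - \<alpha>)"

definition L2_const :: real where
  "L2_const = 8 * stable_tail_const \<alpha> * moment_ratio \<alpha> / (moment_ratio \<alpha> - 1)"

lemma L2_const_nonneg: "L2_const \<ge> 0"
  unfolding L2_const_def using moment_ratio_gt_1[OF alpha_lt_2] stable_tail_const_nonneg[of \<alpha>]
  by (intro divide_nonneg_pos mult_nonneg_nonneg) auto

lemma decay_rate_bounds: "0 < decay_rate" "decay_rate < 1"
proof -
  show "0 < decay_rate" by (simp add: decay_rate_def)
  have "4 powr (1 - \<alpha>) < 4 powr 0" by (subst powr_less_cancel_iff) (use alpha_gt_1 in auto)
  thus "decay_rate < 1" by (simp add: decay_rate_def)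
qed

lemma Z_moment_bound_div_Dk_le:
  assumes "k \<ge> 1"
  shows "Z_moment_bound k / real (Dk \<alpha> k) \<le> L2_const * decay_rate ^ (2 * k) / real k"
proof -
  define r where "r = moment_ratio \<alpha>"
  define A where "A = stable_tail_const \<alpha>"
  have "r > 1" using moment_ratio_gt_1[OF alpha_lt_2] by (simp add: r_def)
  have "A \<ge> 0" by (simp add: A_def stable_tail_const_nonneg)
  have "(real k powr (-1 / \<alpha>)) powr \<alpha> = real k powr (-1 / \<alpha> * \<alpha>)" by (simp only: powr_powr)
  also have "-1 / \<alpha> * \<alpha> = -1" using alpha_gt_1 by simp
  finally have scale: "(real k powr (-1 / \<alpha>)) powr \<alpha> = 1 / real k"
    using assms by (simp add: powr_minus divide_inverse)
  have moment: "Z_moment_bound k = (4 * A * r / (r - 1)) * (r ^ (2 * k) / real k)"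
    unfolding Z_moment_bound_def scale A_def[symmetric] r_def[symmetric] by (simp add: field_simps)
  have "Z_moment_bound k / real (Dk \<alpha> k) \<le> Z_moment_bound k / (4 powr (\<alpha> * real k) / 2)"
    unfolding moment using \<open>r > 1\<close> \<open>A \<ge> 0\<close> Dk_ge_half[OF alpha_gt_1 assms] Dk_ge_1[OF alpha_gt_1 assms]
    by (intro divide_left_mono) auto
  also have "\<dots> = (2 * (4 * A * r / (r - 1))) * ((r ^ (2 * k) / 4 powr (\<alpha> * real k)) / real k)"
    unfolding moment by (simp add: field_simps)
  also have "\<dots> = L2_const * decay_rate ^ (2 * k) / real k"
    unfolding r_def moment_ratio_power_div L2_const_def decay_rate_def A_def by (simp add: field_simps)
  finally show ?thesis .
qed

lemma centered_birkhoff_L1: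
  assumes "k \<ge> 2" and "n \<le> Dk \<alpha> k"
  shows "(\<integral>x. \<bar>centered_birkhoff n k x\<bar> \<partial>M) \<le> real n * sqrt L2_const * decay_rate ^ k / sqrt (real k)"
proof -
  have "k \<ge> 1" using assms by simp
  have "(\<integral>x. \<bar>centered_birkhoff n k x\<bar> \<partial>M) \<le> sqrt (\<integral>x. (centered_birkhoff n k x)\<^sup>2 \<partial>M)"
    by (rule M.integral_abs_le_sqrt_integral_square[OF integrable_centered_birkhoff[OF \<open>k \<ge> 1\<close>]
          centered_birkhoff_L2(1)[OF assms]])
  also have "\<dots> \<le> sqrt ((real n)\<^sup>2 * (Z_moment_bound k / real (Dk \<alpha> k)))"
    using centered_birkhoff_L2(2)[OF assms] by (simp add: real_sqrt_le_mono)
  also have "\<dots> \<le> sqrt ((real n)\<^sup>2 * (L2_const * (decay_rate ^ k)\<^sup>2 / real k))"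
    using Z_moment_bound_div_Dk_le[OF \<open>k \<ge> 1\<close>]
    by (intro real_sqrt_le_mono mult_left_mono) (auto simp: power_mult[symmetric] mult.commute)
  also have "\<dots> = real n * sqrt L2_const * decay_rate ^ k / sqrt (real k)"
    using decay_rate_bounds by (simp add: real_sqrt_mult real_sqrt_divide)
  finally show ?thesis .
qed

definition cutoff :: "nat \<Rightarrow> real" where
  "cutoff n = log 2 (real n) / (2 * \<alpha>)"

definition tail_term :: "nat \<Rightarrow> nat \<Rightarrow> 'a \<Rightarrow> real" where
  "tail_term n k x = (if cutoff n < real k then centered_birkhoff n k x else 0)"

lemma cutoff_nonneg: "n \<ge> 1 \<Longrightarrow> cutoff n \<ge> 0"
  unfolding cutoff_def using alpha_gt_1 by simp

lemma integrable_tail_term: "n \<ge> 1 \<Longrightarrow> integrable M (tail_term n k)"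
  using cutoff_nonneg[of n] integrable_centered_birkhoff[of k n]
  by (cases "cutoff n < real k") (auto simp: tail_term_def[abs_def])

lemma integral_abs_tail_term_le:
  assumes "n \<ge> 1" and "k \<ge> 2" and "cutoff n < real k"
  shows "(\<integral>x. \<bar>tail_term n k x\<bar> \<partial>M) \<le> real n * sqrt L2_const * decay_rate ^ k / sqrt (real k)"
proof -
  have "n \<le> Dk \<alpha> k"
    by (rule le_Dk_if_log_less) (use assms alpha_gt_1 in \<open>auto simp: cutoff_def\<close>)
  thus ?thesis using centered_birkhoff_L1[OF \<open>k \<ge> 2\<close>] assms(3) by (simp add: tail_term_def)
qed

lemma summable_integral_abs_tail_term:
  assumes "n \<ge> 1"
  shows "summable (\<lambda>k. \<integral>x. \<bar>tail_term n k x\<bar> \<partial>M)"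
proof (rule summable_comparison_test')
  show "summable (\<lambda>k. real n * sqrt L2_const * decay_rate ^ k)"
    using decay_rate_bounds by (intro summable_mult summable_geometric) auto
  show "norm (\<integral>x. \<bar>tail_term n k x\<bar> \<partial>M) \<le> real n * sqrt L2_const * decay_rate ^ k" if "k \<ge> 2" for k
  proof (cases "cutoff n < real k")
    case True
    have "0 \<le> real n * sqrt L2_const * decay_rate ^ k" using decay_rate_bounds L2_const_nonneg by simp
    moreover have "sqrt (real k) \<ge> 1" using that by simp
    ultimately have "real n * sqrt L2_const * decay_rate ^ k / sqrt (real k) \<le> real n * sqrt L2_const * decay_rate ^ k"
      by (simp add: divide_le_eq mult_le_cancel_left1)
    thus ?thesis using integral_abs_tail_term_le[OF assms that True] by simp
  qed (use decay_rate_bounds L2_const_nonneg in \<open>auto simp: tail_term_def\<close>)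
qed

lemma decay_rate_powr_cutoff:
  assumes "n \<ge> 1"
  shows "decay_rate powr cutoff n = real n powr ((1 - \<alpha>) / \<alpha>)"
proof -
  have "decay_rate powr cutoff n = (2 powr 2) powr ((1 - \<alpha>) * cutoff n)"
    unfolding decay_rate_def by (simp add: powr_powr)
  also have "\<dots> = 2 powr (2 * ((1 - \<alpha>) * cutoff n))" by (simp only: powr_powr)
  also have "2 * ((1 - \<alpha>) * cutoff n) = log 2 (real n) * ((1 - \<alpha>) / \<alpha>)"
    unfolding cutoff_def using alpha_gt_1 by (simp add: field_simps)
  also have "2 powr (log 2 (real n) * ((1 - \<alpha>) / \<alpha>)) = (2 powr log 2 (real n)) powr ((1 - \<alpha>) / \<alpha>)"
    by (simp only: powr_powr)
  also have "\<dots> = real n powr ((1 - \<alpha>) / \<alpha>)" using assms by simp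
  finally show ?thesis .
qed

lemma sum_integral_abs_tail_term_le:
  assumes "n \<ge> 16"
  shows "(\<Sum>k. \<integral>x. \<bar>tail_term n k x\<bar> \<partial>M)
    \<le> real n * real n powr ((1 - \<alpha>) / \<alpha>) * sqrt L2_const / ((1 - decay_rate) * sqrt (cutoff n))"
proof -
  have "n \<ge> 1" using assms by simp
  have "4 = log 2 ((2::real) ^ 4)" by (subst log_nat_power) auto
  also have "\<dots> \<le> log 2 (real n)" using assms by simp
  finally have "log 2 (real n) \<ge> 4" .
  hence cutoff_gt_1: "cutoff n > 1" unfolding cutoff_def using alpha_gt_1 alpha_lt_2 by (simp add: field_simps)
  define K where "K = nat \<lfloor>cutoff n\<rfloor> + 1"
  have K_iff: "cutoff n < real k \<longleftrightarrow> K \<le> k" for k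
    unfolding K_def using cutoff_gt_1 by linarith
  define c where "c = real n * sqrt L2_const / sqrt (cutoff n)"
  have "c \<ge> 0" unfolding c_def using L2_const_nonneg cutoff_gt_1 by simp
  have geometric: "(\<lambda>k. c * (if K \<le> k then decay_rate ^ k else 0)) sums (c * (decay_rate ^ K / (1 - decay_rate)))"
    by (intro sums_mult sums_geometric_from decay_rate_bounds)
  have term_le: "(\<integral>x. \<bar>tail_term n k x\<bar> \<partial>M) \<le> c * (if K \<le> k then decay_rate ^ k else 0)" for k
  proof (cases "cutoff n < real k")
    case True
    have "(\<integral>x. \<bar>tail_term n k x\<bar> \<partial>M) \<le> real n * sqrt L2_const * decay_rate ^ k / sqrt (real k)"
      using integral_abs_tail_term_le[OF \<open>n \<ge> 1\<close> _ True] True cutoff_gt_1 by simp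
    also have "\<dots> \<le> real n * sqrt L2_const * decay_rate ^ k / sqrt (cutoff n)"
      using True cutoff_gt_1 decay_rate_bounds L2_const_nonneg by (intro divide_left_mono) auto
    finally show ?thesis using True K_iff by (simp add: c_def)
  qed (use K_iff in \<open>simp add: tail_term_def\<close>)
  have "(\<Sum>k. \<integral>x. \<bar>tail_term n k x\<bar> \<partial>M) \<le> c * (decay_rate ^ K / (1 - decay_rate))"
    using suminf_le[OF term_le summable_integral_abs_tail_term[OF \<open>n \<ge> 1\<close>] sums_summable[OF geometric]]
      geometric by (simp add: sums_iff)
  also have "decay_rate ^ K \<le> decay_rate powr cutoff n"
    using decay_rate_bounds K_iff[of K]
    by (simp add: powr_realpow[symmetric]) (intro powr_mono'; simp)
  hence "c * (decay_rate ^ K / (1 - decay_rate)) \<le> c * (decay_rate powr cutoff n / (1 - decay_rate))"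
    using \<open>c \<ge> 0\<close> decay_rate_bounds by (intro mult_left_mono divide_right_mono) auto
  finally show ?thesis
    unfolding c_def decay_rate_powr_cutoff[OF \<open>n \<ge> 1\<close>] by (simp add: field_simps)
qed

lemma partial_sum_eq_sum_tail_term:
  "(\<Sum>k\<in>{k. log 2 (real n) / (2 * \<alpha>) < real k \<and> k \<le> K}.
      birkhoff_sum T n (\<lambda>y. phik \<alpha> T f k y - (\<integral>z. phik \<alpha> T f k z \<partial>M)) x) = (\<Sum>k\<le>K. tail_term n k x)"
proof -
  have "{k. log 2 (real n) / (2 * \<alpha>) < real k \<and> k \<le> K} = {..K} \<inter> {k. cutoff n < real k}"
    unfolding cutoff_def by auto
  thus ?thesis
    unfolding tail_term_def centered_birkhoff_def by (simp add: sum.inter_restrict)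
qed

definition tail_series :: "nat \<Rightarrow> 'a \<Rightarrow> real" where
  "tail_series n x = (\<Sum>k. tail_term n k x)"

lemma normalised_tail_series_L1:
  "(\<lambda>n. \<integral>x. \<bar>real n powr (-1 / \<alpha>) * tail_series n x\<bar> \<partial>M) \<longlonglongrightarrow> 0"
proof -
  define C where "C = sqrt L2_const * sqrt (2 * \<alpha>) / (1 - decay_rate)"
  have bound: "(\<integral>x. \<bar>real n powr (-1 / \<alpha>) * tail_series n x\<bar> \<partial>M) \<le> C / sqrt (log 2 (real n))"
    if "n \<ge> 16" for n
  proof -
    have "n \<ge> 1" using that by simp
    have "(\<integral>x. \<bar>real n powr (-1 / \<alpha>) * tail_series n x\<bar> \<partial>M)
        = real n powr (-1 / \<alpha>) * (\<integral>x. \<bar>tail_series n x\<bar> \<partial>M)"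
      by (simp add: abs_mult)
    also have "\<dots> \<le> real n powr (-1 / \<alpha>) *
        (real n * real n powr ((1 - \<alpha>) / \<alpha>) * sqrt L2_const / ((1 - decay_rate) * sqrt (cutoff n)))"
      using L1_convergence_suminf(3)[OF integrable_tail_term summable_integral_abs_tail_term, OF \<open>n \<ge> 1\<close> \<open>n \<ge> 1\<close>]
        sum_integral_abs_tail_term_le[OF that]
      by (intro mult_left_mono) (auto simp: tail_series_def)
    also have "real n powr (-1 / \<alpha>) * real n * real n powr ((1 - \<alpha>) / \<alpha>) = 1"
      using \<open>n \<ge> 1\<close> alpha_gt_1
      by (simp add: powr_add[symmetric] powr_mult_base add_divide_distrib[symmetric] field_simps)
    hence "real n powr (-1 / \<alpha>) *
        (real n * real n powr ((1 - \<alpha>) / \<alpha>) * sqrt L2_const / ((1 - decay_rate) * sqrt (cutoff n)))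
      = C / sqrt (log 2 (real n))"
      unfolding C_def cutoff_def using alpha_gt_1 decay_rate_bounds
      by (simp add: real_sqrt_divide field_simps)
    finally show ?thesis .
  qed
  have "(\<lambda>n::nat. C / sqrt (log 2 (real n))) \<longlonglongrightarrow> 0"
    by real_asymp
  then show ?thesis
  proof (rule tendsto_sandwich[OF _ _ tendsto_const, rotated 2])
    show "\<forall>\<^sub>F n in sequentially. 0 \<le> (\<integral>x. \<bar>real n powr (-1 / \<alpha>) * tail_series n x\<bar> \<partial>M)"
      by (intro always_eventually allI integral_nonneg_AE) auto
    show "\<forall>\<^sub>F n in sequentially.
        (\<integral>x. \<bar>real n powr (-1 / \<alpha>) * tail_series n x\<bar> \<partial>M) \<le> C / sqrt (log 2 (real n))"
      using bound by (intro eventually_sequentiallyI[of 16])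
  qed
qed

end

theorem lemma5p2:
  fixes M :: "'a measure" and T :: "'a \<Rightarrow> 'a"
    and P :: "'b measure" and X :: "nat \<Rightarrow> nat \<Rightarrow> 'b \<Rightarrow> real"
    and f :: "nat \<Rightarrow> 'a \<Rightarrow> real" and \<alpha> :: real
  assumes "1 < \<alpha>" and "\<alpha> < 2"
    and "ergodic_aperiodic_pps M T"
    and "triangular_array \<alpha> P X"
    and "admissible_system M T P X f"
  shows "\<exists>V :: nat \<Rightarrow> 'a \<Rightarrow> real.
     (\<forall>n::nat. n \<ge> 1 \<longrightarrow>
        V n \<in> borel_measurable M \<and> integrable M (V n) \<and>
        (\<lambda>K::nat. \<integral>x. \<bar>(\<Sum>k\<in>{k. log 2 (real n) / (2 * \<alpha>) < real k \<and> k \<le> K}.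
                birkhoff_sum T n (\<lambda>y. phik \<alpha> T f k y - (\<integral>z. phik \<alpha> T f k z \<partial>M)) x) - V n x\<bar> \<partial>M)
          \<longlonglongrightarrow> 0) \<and>
     (\<forall>\<epsilon>>0. (\<lambda>n::nat. measure M {x \<in> space M. \<bar>real n powr (-1 / \<alpha>) * V n x\<bar> > \<epsilon>})
          \<longlonglongrightarrow> 0)"
proof -
  interpret admissible_setting M T P X f \<alpha>
    using assms by unfold_locales
  have L1_limit: "integrable M (tail_series n)"
    "(\<lambda>K. \<integral>x. \<bar>(\<Sum>k\<le>K. tail_term n k x) - tail_series n x\<bar> \<partial>M) \<longlonglongrightarrow> 0" if "n \<ge> 1" for n
    using L1_convergence_suminf[OF integrable_tail_term summable_integral_abs_tail_term, OF that that]
    by (simp_all add: tail_series_def[abs_def])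
  have "(\<lambda>n. measure M {x \<in> space M. \<bar>real n powr (-1 / \<alpha>) * tail_series n x\<bar> > \<epsilon>}) \<longlonglongrightarrow> 0"
    if "\<epsilon> > 0" for \<epsilon>
    using L1_limit(1)
    by (intro M.measure_abs_gt_tendsto_0_of_L1 normalised_tail_series_L1 that)
       (auto simp: eventually_sequentially)
  with L1_limit show ?thesis
    by (intro exI[of _ tail_series]) (auto simp: partial_sum_eq_sum_tail_term)
qed

end
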